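(* Consider a normalized Hamburger moment problem with orthonormal polynomials $P_n$, polynomials of the second kind $Q_n$ and recurrence coefficients $a_n\in\mathbb R$, $b_n>0$. Assume that $$\sum_{n=1}^\infty\frac{1+|a_n|}{\sqrt{b_nb_{n-1}}}<\infty,$$ and that there is $n_0\ge1$ such that either $b_n^2\le b_{n-1}b_{n+1}$ for all $n\ge n_0$, or $b_n^2\ge b_{n-1}b_{n+1}$ for all $n\ge n_0$. Assume in addition that the function $P$ satisfies $$P(z)\le C\exp(K|z|^\alpha),\quad z\in\mathbb C,$$ for some $\alpha$ with $0<\alpha<1$ and suitable constants $C,K>0$. Then, as $n\to\infty$, $$1/b_n,\ P_n^2(0),\ Q_n^2(0)=O(n^{-1/\alpha}),$$ so in particular $(1/b_n),(P_n^2(0)),(Q_n^2(0))\in\ell^{\alpha+\varepsilon}$ for any $\varepsilon>0$.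
   Context: A normalized Hamburger moment problem is given by a sequence $s_n=\int_{-\infty}^\infty x^n\,d\mu(x)$, $n\ge0$, where $\mu$ is a probability measure on $\mathbb R$ with infinite support and moments of every order. Let $P_n$ be the orthonormal polynomials (positive leading coefficients) and $Q_n$ the polynomials of the second kind. Both are solutions of $$z r_n(z)=b_nr_{n+1}(z)+a_nr_n(z)+b_{n-1}r_{n-1}(z),\quad n\ge0,$$ with $a_n\in\mathbb R$, $b_n>0$ for $n\ge 0$, $b_{-1}=1$, and initial conditions $P_0=1$, $P_{-1}=0$, $Q_0=0$, $Q_{-1}=-1$. Put $P(z)=(\sum_{n\ge0}|P_n(z)|^2)^{1/2}$. For $\alpha>0$, $\ell^\alpha=\{(x_n)\mid \sum_{n}|x_n|^\alpha<\infty\}$. *)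

theory Defs
  imports
    "HOL-Probability.Probability"
    "HOL-Computational_Algebra.Polynomial"
    "HOL-Library.Landau_Symbols"
begin

definition measure_support :: "real measure \<Rightarrow> real set" where
  "measure_support \<mu> = {x. \<forall>U. open U \<and> x \<in> U \<longrightarrow> emeasure \<mu> U > 0}"

text \<open>The measure \<open>\<mu>\<close> is one representing measure of the moment sequence \<open>s\<close>; the moment
  problem itself may be determinate or indeterminate.\<close>

definition normalized_hamburger_problem :: "(nat \<Rightarrow> real) \<Rightarrow> real measure \<Rightarrow> bool" where
  "normalized_hamburger_problem s \<mu> \<longleftrightarrow>
     real_distribution \<mu> \<and> infinite (measure_support \<mu>) \<and>
     (\<forall>n. integrable \<mu> (\<lambda>x. x ^ n)) \<and>
     (\<forall>n. s n = (\<integral>x. x ^ n \<partial>\<mu>))"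

definition orthonormal_polys :: "real measure \<Rightarrow> (nat \<Rightarrow> real poly) \<Rightarrow> bool" where
  "orthonormal_polys \<mu> P \<longleftrightarrow>
     (\<forall>n. degree (P n) = n \<and> lead_coeff (P n) > 0) \<and>
     (\<forall>m n. (\<integral>x. poly (P m) x * poly (P n) x \<partial>\<mu>) = (if m = n then 1 else 0))"

text \<open>The three-term recurrence \<open>z r\<^sub>n(z) = b\<^sub>n r\<^sub>n\<^sub>+\<^sub>1(z) + a\<^sub>n r\<^sub>n(z) + b\<^sub>n\<^sub>-\<^sub>1 r\<^sub>n\<^sub>-\<^sub>1(z)\<close> for all
  \<open>n \<ge> 0\<close>, with initial values \<open>r\<^sub>-\<^sub>1 = u\<close> and \<open>r\<^sub>0 = v\<close> and the convention \<open>b\<^sub>-\<^sub>1 = 1\<close>, so that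
  for \<open>n = 0\<close> the last summand is \<open>u\<close>.\<close>

definition jacobi_recurrence ::
  "(nat \<Rightarrow> real) \<Rightarrow> (nat \<Rightarrow> real) \<Rightarrow> real poly \<Rightarrow> real poly \<Rightarrow> (nat \<Rightarrow> real poly) \<Rightarrow> bool" where
  "jacobi_recurrence a b u v r \<longleftrightarrow>
     r 0 = v \<and>
     (\<forall>n. monom 1 1 * r n =
        smult (b n) (r (Suc n)) + smult (a n) (r n) +
        (case n of 0 \<Rightarrow> u | Suc m \<Rightarrow> smult (b m) (r m)))"

text \<open>\<open>a\<close>, \<open>b\<close> are the recurrence coefficients of the orthonormal polynomials \<open>P\<close>, and \<open>Q\<close> is the
  solution of the same recurrence with \<open>Q\<^sub>-\<^sub>1 = -1\<close>, \<open>Q\<^sub>0 = 0\<close>.\<close>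

definition hamburger_data ::
  "(nat \<Rightarrow> real) \<Rightarrow> real measure \<Rightarrow> (nat \<Rightarrow> real poly) \<Rightarrow> (nat \<Rightarrow> real poly) \<Rightarrow>
   (nat \<Rightarrow> real) \<Rightarrow> (nat \<Rightarrow> real) \<Rightarrow> bool" where
  "hamburger_data s \<mu> P Q a b \<longleftrightarrow>
     normalized_hamburger_problem s \<mu> \<and> orthonormal_polys \<mu> P \<and>
     (\<forall>n. b n > 0) \<and>
     jacobi_recurrence a b 0 1 P \<and> jacobi_recurrence a b (- 1) 0 Q"

definition ceval :: "real poly \<Rightarrow> complex \<Rightarrow> complex" where
  "ceval p z = poly (map_poly complex_of_real p) z"

text \<open>\<open>P(z) = (\<Sum>\<^sub>n |P\<^sub>n(z)|\<^sup>2)\<^sup>1\<^sup>/\<^sup>2\<close>, with value \<open>\<infinity>\<close> where the series diverges.\<close>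

definition P_fun :: "(nat \<Rightarrow> real poly) \<Rightarrow> complex \<Rightarrow> ereal" where
  "P_fun P z =
     (if summable (\<lambda>n. (cmod (ceval (P n) z))\<^sup>2)
      then ereal (sqrt (\<Sum>n. (cmod (ceval (P n) z))\<^sup>2)) else \<infinity>)"

definition ell :: "real \<Rightarrow> (nat \<Rightarrow> real) set" where
  "ell \<alpha> = {x. summable (\<lambda>n. \<bar>x n\<bar> powr \<alpha>)}"

end

theory Submission
  imports Defs "HOL-Complex_Analysis.Cauchy_Integral_Formula" "HOL-Real_Asymp.Real_Asymp"
begin

text \<open>The leading coefficient of \<open>P\<^sub>n\<close> is \<open>1 / (b\<^sub>0 \<cdots> b\<^sub>n\<^sub>-\<^sub>1)\<close>, and Cauchy's estimate on the circle of
  radius \<open>n\<^sup>1\<^sup>/\<^sup>\<alpha>\<close> bounds it by \<open>C (e\<^sup>K n\<^sup>-\<^sup>1\<^sup>/\<^sup>\<alpha>)\<^sup>n\<close>. Either regularity condition makes \<open>b\<^sub>n\<^sub>+\<^sub>1 / b\<^sub>n\<close>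
  eventually monotone; summability rules out that \<open>b\<close> is eventually decreasing, so \<open>b\<close> is eventually
  increasing, the product is at most a multiple of \<open>b\<^sub>n\<^sup>n\<close>, and \<open>1 / b\<^sub>n = O(n\<^sup>-\<^sup>1\<^sup>/\<^sup>\<alpha>)\<close> follows.
  The recurrence at \<open>0\<close>, rescaled by \<open>\<surd>b\<^sub>n\<^sub>-\<^sub>1\<close> or \<open>\<surd>b\<^sub>n\<close> according to the regularity condition, becomes
  \<open>v\<^sub>n\<^sub>+\<^sub>2 \<le> \<epsilon>\<^sub>n v\<^sub>n\<^sub>+\<^sub>1 + v\<^sub>n\<close> with summable \<open>\<epsilon>\<close>, hence \<open>v\<close> is bounded and
  \<open>P\<^sub>n(0)\<^sup>2, Q\<^sub>n(0)\<^sup>2 = O(1 / b\<^sub>n\<^sub>-\<^sub>1)\<close>.\<close>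

section \<open>Two-step recursions and the monotonicity of \<open>b\<close>\<close>

text \<open>A discrete Gronwall argument: the maximum of two consecutive terms grows in each step by
  a factor of at most \<open>1 + e n\<close>, hence \<open>exp (e n)\<close>, and summability bounds
  the product of these factors.\<close>

lemma bounded_of_two_step_recursion:
  fixes v e :: "nat \<Rightarrow> real"
  assumes v: "\<And>n. 0 \<le> v n" and e: "\<And>n. 0 \<le> e n" "summable e"
    and step: "\<And>n. v (n + 2) \<le> e n * v (n + 1) + v n"
  shows "\<exists>M. \<forall>n. v n \<le> M"
proof -
  define m where "m = max (v 0) (v 1)"
  have m: "0 \<le> m" using v[of 0] by (simp add: m_def)
  have key: "max (v n) (v (Suc n)) \<le> m * exp (\<Sum>i<n. e i)" for n
  proof (induction n)
    case 0
    then show ?case by (simp add: m_def)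
  next
    case (Suc n)
    let ?B = "m * exp (\<Sum>i<n. e i)"
    have B: "v n \<le> ?B" "v (Suc n) \<le> ?B" using Suc by auto
    have "?B * 1 \<le> ?B * exp (e n)" using m e(1)[of n] by (intro mult_left_mono) auto
    moreover have "v (n + 2) \<le> e n * ?B + ?B"
      using step[of n] mult_left_mono[OF B(2) e(1)[of n]] B(1) by simp
    moreover have "e n * ?B + ?B = ?B * (1 + e n)" by (simp add: algebra_simps)
    moreover have "?B * (1 + e n) \<le> ?B * exp (e n)"
      using m by (intro mult_left_mono exp_ge_add_one_self) auto
    ultimately show ?case using B(2) by (simp add: exp_add mult.assoc)
  qed
  have "v n \<le> m * exp (suminf e)" for n
  proof -
    have "(\<Sum>i<n. e i) \<le> suminf e" using e by (intro sum_le_suminf) auto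
    then have "m * exp (\<Sum>i<n. e i) \<le> m * exp (suminf e)"
      using m by (intro mult_left_mono) auto
    then show ?thesis using key[of n] by simp
  qed
  then show ?thesis by blast
qed

text \<open>In the first case one increase after \<open>n0\<close> propagates forward, in the second
  one decrease does. An eventually decreasing \<open>b\<close> is bounded, so the terms of the
  series would stay away from 0.\<close>

lemma log_regular_eventually_incseq:
  fixes b :: "nat \<Rightarrow> real"
  assumes pos: "\<And>n. b n > 0"
    and sm: "summable (\<lambda>n. 1 / sqrt (b (Suc n) * b n))"
    and reg: "(\<forall>n\<ge>n0. (b (Suc n))\<^sup>2 \<le> b n * b (n + 2)) \<or>
              (\<forall>n\<ge>n0. (b (Suc n))\<^sup>2 \<ge> b n * b (n + 2))"
  shows "\<exists>N. \<forall>n\<ge>N. b n \<le> b (Suc n)"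
proof -
  have not_dec: "\<not> (\<forall>n\<ge>N. b (Suc n) \<le> b n)" for N
  proof
    assume dec: "\<forall>n\<ge>N. b (Suc n) \<le> b n"
    have le: "b (N + k) \<le> b N" for k
      by (induction k) (use dec in \<open>auto intro: order_trans[OF dec[rule_format]]\<close>)
    have "1 / b N \<le> 1 / sqrt (b (Suc n) * b n)" if "n \<ge> N" for n
    proof -
      have "b n \<le> b N" "b (Suc n) \<le> b N"
        using le[of "n - N"] le[of "Suc n - N"] that by (auto simp: Suc_diff_le)
      then have "b (Suc n) * b n \<le> b N * b N"
        using pos[of n] pos[of N] by (intro mult_mono) auto
      then have "sqrt (b (Suc n) * b n) \<le> b N"
        using pos[of N] real_sqrt_le_mono by fastforce
      then show ?thesis using pos by (intro divide_left_mono mult_pos_pos) auto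
    qed
    moreover have "(\<lambda>n. 1 / sqrt (b (Suc n) * b n)) \<longlonglongrightarrow> 0"
      using sm by (rule summable_LIMSEQ_zero)
    ultimately have "1 / b N \<le> 0" by (intro LIMSEQ_le_const) auto
    then show False using pos[of N] by simp
  qed
  from reg show ?thesis
  proof
    assume convex: "\<forall>n\<ge>n0. (b (Suc n))\<^sup>2 \<le> b n * b (n + 2)"
    obtain N where N: "N \<ge> n0" "b N \<le> b (Suc N)"
      using not_dec[of n0] by (meson linear)
    have "b n \<le> b (Suc n)" if "n \<ge> N" for n
      using that
    proof (induction n rule: dec_induct)
      case (step n)
      have "b (Suc n) * b n \<le> b (Suc n) * b (Suc n)"
        using step pos[of "Suc n"] by (intro mult_left_mono) auto
      also have "\<dots> \<le> b (n + 2) * b n"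
        using convex step N by (simp add: power2_eq_square mult.commute)
      finally show ?case using pos[of n] by simp
    qed (use N in auto)
    then show ?thesis by blast
  next
    assume concave: "\<forall>n\<ge>n0. (b (Suc n))\<^sup>2 \<ge> b n * b (n + 2)"
    have "b n \<le> b (Suc n)" if "n \<ge> n0" for n
    proof (rule ccontr)
      assume less: "\<not> b n \<le> b (Suc n)"
      have "b (Suc k) \<le> b k" if "k \<ge> n" for k
        using that
      proof (induction k rule: dec_induct)
        case (step k)
        have "b (k + 2) * b k \<le> b (Suc k) * b (Suc k)"
          using concave step \<open>n \<ge> n0\<close> by (simp add: power2_eq_square mult.commute)
        also have "\<dots> \<le> b (Suc k) * b k"
          using step pos[of "Suc k"] by (intro mult_left_mono) auto
        finally show ?case using pos[of k] by simp
      qed (use less in auto)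
      then show False using not_dec by blast
    qed
    then show ?thesis by blast
  qed
qed

text \<open>The weight \<open>sqrt (b n)\<close> goes with \<open>r (Suc n)\<close> in the first
  case and with \<open>r n\<close> in the second; in each, the regularity condition makes the
  coefficient of the oldest term at most 1.\<close>

lemma recurrence_solution_square_bigo:
  fixes a b r :: "nat \<Rightarrow> real"
  assumes pos: "\<And>n. b n > 0"
    and sm: "summable (\<lambda>n. (1 + \<bar>a (Suc n)\<bar>) / sqrt (b (Suc n) * b n))"
    and reg: "(\<forall>n\<ge>n0. (b (Suc n))\<^sup>2 \<le> b n * b (n + 2)) \<or>
              (\<forall>n\<ge>n0. (b (Suc n))\<^sup>2 \<ge> b n * b (n + 2))"
    and incr: "\<And>n. n \<ge> N \<Longrightarrow> b n \<le> b (Suc n)"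
    and rec: "\<And>n. b (Suc n) * r (n + 2) + a (Suc n) * r (Suc n) + b n * r n = 0"
  shows "(\<lambda>n. (r (Suc n))\<^sup>2) \<in> O(\<lambda>n. 1 / b n)"
proof -
  define e where "e n = \<bar>a (Suc n)\<bar> / sqrt (b (Suc n) * b n)" for n
  have e0: "0 \<le> e n" for n
    using pos[of n] pos[of "Suc n"] by (simp add: e_def)
  have e_sm: "summable e"
    using sm
  proof (rule summable_comparison_test'[where N = 0])
    fix n
    show "norm (e n) \<le> (1 + \<bar>a (Suc n)\<bar>) / sqrt (b (Suc n) * b n)"
      using e0[of n] pos[of n] pos[of "Suc n"] by (simp add: e_def divide_right_mono)
  qed
  have r_le: "b (Suc n) * \<bar>r (n + 2)\<bar> \<le> \<bar>a (Suc n)\<bar> * \<bar>r (Suc n)\<bar> + b n * \<bar>r n\<bar>" for n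
  proof -
    have "b (Suc n) * r (n + 2) = - (a (Suc n) * r (Suc n)) - b n * r n"
      using rec[of n] by simp
    then have "\<bar>b (Suc n) * r (n + 2)\<bar> \<le> \<bar>a (Suc n) * r (Suc n)\<bar> + \<bar>b n * r n\<bar>"
      by linarith
    then show ?thesis using pos by (simp add: abs_mult abs_of_pos)
  qed
  have s0: "sqrt (b n) > 0" and ss: "sqrt (b n) * sqrt (b n) = b n" for n
    using pos[of n] by auto
  have "\<exists>M k. \<forall>n\<ge>k. sqrt (b n) * \<bar>r (Suc n)\<bar> \<le> M"
    using reg
  proof
    assume convex: "\<forall>n\<ge>n0. (b (Suc n))\<^sup>2 \<le> b n * b (n + 2)"
    define v where "v n = sqrt (b (n + n0)) * \<bar>r (Suc (n + n0))\<bar>" for n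
    have "\<exists>M. \<forall>n. v n \<le> M"
    proof (rule bounded_of_two_step_recursion)
      \<comment> \<open>The shift is \<open>Suc n0\<close> because this \<open>v\<close> involves
        \<open>r\<close> one index later, so the recurrence is applied at
        \<open>Suc ?k\<close>.\<close>
      show "summable (\<lambda>n. e (n + Suc n0))" using e_sm by (subst summable_iff_shift)
      fix n
      let ?k = "n + n0"
      define x y z where "x = sqrt (b ?k)" and "y = sqrt (b (?k + 1))" and "z = sqrt (b (?k + 2))"
      have xyz: "x > 0" "y > 0" "z > 0" by (simp_all add: x_def y_def z_def pos)
      have sq: "b ?k = x * x" "b (?k + 1) = y * y" "b (?k + 2) = z * z"
        by (simp_all only: x_def y_def z_def ss)
      have "(y * y)\<^sup>2 \<le> (x * z)\<^sup>2"
        using convex[rule_format, of ?k] sq by (simp add: power2_eq_square ac_simps)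
      then have yy: "y * y \<le> x * z" using xyz by (simp add: power2_le_iff_abs_le)
      have "z * z * \<bar>r (?k + 3)\<bar> \<le> \<bar>a (?k + 2)\<bar> * \<bar>r (?k + 2)\<bar> + y * y * \<bar>r (?k + 1)\<bar>"
        using r_le[of "Suc ?k"] sq by (simp add: numeral_eq_Suc)
      \<comment> \<open>Replacing \<open>y * y\<close> by \<open>x * z\<close> turns the oldest
        term, after division by \<open>z\<close>, into exactly \<open>v n\<close>.\<close>
      also have "\<dots> \<le> \<bar>a (?k + 2)\<bar> * \<bar>r (?k + 2)\<bar> + x * z * \<bar>r (?k + 1)\<bar>"
        using yy by (intro add_left_mono mult_right_mono) auto
      finally have "z * \<bar>r (?k + 3)\<bar> \<le> \<bar>a (?k + 2)\<bar> / (z * y) * (y * \<bar>r (?k + 2)\<bar>) + x * \<bar>r (?k + 1)\<bar>"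
        using xyz by (simp add: field_simps)
      then show "v (n + 2) \<le> e (n + Suc n0) * v (n + 1) + v n"
        by (simp add: v_def e_def x_def y_def z_def real_sqrt_mult numeral_eq_Suc)
    qed (use pos e0 in \<open>auto simp: v_def less_imp_le\<close>)
    then obtain M where M: "\<And>n. v n \<le> M" by blast
    have "sqrt (b n) * \<bar>r (Suc n)\<bar> \<le> M" if "n \<ge> n0" for n
      using M[of "n - n0"] that by (simp add: v_def)
    then show ?thesis by blast
  next
    assume concave: "\<forall>n\<ge>n0. (b (Suc n))\<^sup>2 \<ge> b n * b (n + 2)"
    define v where "v n = sqrt (b (n + n0)) * \<bar>r (n + n0)\<bar>" for n
    have "\<exists>M. \<forall>n. v n \<le> M"
    proof (rule bounded_of_two_step_recursion)
      show "summable (\<lambda>n. e (n + n0))" using e_sm by (subst summable_iff_shift)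
      fix n
      let ?k = "n + n0"
      define x y z where "x = sqrt (b ?k)" and "y = sqrt (b (?k + 1))" and "z = sqrt (b (?k + 2))"
      have xyz: "x > 0" "y > 0" "z > 0" by (simp_all add: x_def y_def z_def pos)
      have sq: "b ?k = x * x" "b (?k + 1) = y * y" "b (?k + 2) = z * z"
        by (simp_all only: x_def y_def z_def ss)
      have "(x * z)\<^sup>2 \<le> (y * y)\<^sup>2"
        using concave[rule_format, of ?k] sq by (simp add: power2_eq_square ac_simps)
      then have yy: "x * z \<le> y * y" using xyz by (simp add: power2_le_iff_abs_le)
      let ?R = "\<bar>a (?k + 1)\<bar> * \<bar>r (?k + 1)\<bar> + x * x * \<bar>r ?k\<bar>"
      \<comment> \<open>Here the condition bounds \<open>x * z\<close> from above, so it is applied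
        to the newest term; the common factor \<open>x * z\<close> is cancelled at the end.\<close>
      have "(x * z) * (z * \<bar>r (?k + 2)\<bar>) \<le> (y * y) * (z * \<bar>r (?k + 2)\<bar>)"
        using yy xyz by (intro mult_right_mono) auto
      also have "\<dots> = z * (y * y * \<bar>r (?k + 2)\<bar>)" by simp
      also have "\<dots> \<le> z * ?R"
        using r_le[of ?k] sq xyz by (intro mult_left_mono) auto
      also have "\<dots> = (x * z) * (\<bar>a (?k + 1)\<bar> / (y * x) * (y * \<bar>r (?k + 1)\<bar>) + x * \<bar>r ?k\<bar>)"
        using xyz by (simp add: field_simps)
      finally have "z * \<bar>r (?k + 2)\<bar> \<le> \<bar>a (?k + 1)\<bar> / (y * x) * (y * \<bar>r (?k + 1)\<bar>) + x * \<bar>r ?k\<bar>"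
        using xyz by (subst (asm) mult_le_cancel_left_pos) auto
      then show "v (n + 2) \<le> e (n + n0) * v (n + 1) + v n"
        by (simp add: v_def e_def x_def y_def z_def real_sqrt_mult numeral_eq_Suc)
    qed (use pos e0 in \<open>auto simp: v_def less_imp_le\<close>)
    then obtain M where M: "\<And>n. v n \<le> M" by blast
    have "sqrt (b n) * \<bar>r (Suc n)\<bar> \<le> M" if "n \<ge> n0 + N" for n
    proof -
      \<comment> \<open>Monotonicity of \<open>b\<close> moves the weight back by one index, to the
        form reached in the first case.\<close>
      have "sqrt (b n) * \<bar>r (Suc n)\<bar> \<le> sqrt (b (Suc n)) * \<bar>r (Suc n)\<bar>"
        using incr[of n] that by (intro mult_right_mono) auto
      then show ?thesis using M[of "Suc n - n0"] that by (simp add: v_def)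
    qed
    then show ?thesis by blast
  qed
  then obtain M k where M: "\<And>n. n \<ge> k \<Longrightarrow> sqrt (b n) * \<bar>r (Suc n)\<bar> \<le> M" by blast
  have "norm ((r (Suc n))\<^sup>2) \<le> M\<^sup>2 * norm (1 / b n)" if "n \<ge> k" for n
  proof -
    have "(sqrt (b n) * \<bar>r (Suc n)\<bar>)\<^sup>2 \<le> M\<^sup>2"
      using M[OF that] s0[of n] by (intro power_mono) auto
    then show ?thesis using pos[of n] by (simp add: power_mult_distrib field_simps)
  qed
  then show ?thesis by (intro bigoI[of _ "M\<^sup>2"]) (auto simp: eventually_sequentially)
qed

section \<open>Leading coefficients and the decay of \<open>1 / b n\<close>\<close>

text \<open>Cauchy's estimate at \<open>0\<close> for the reflected polynomial \<open>z\<^sup>n p(1/z)\<close>.\<close>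

lemma norm_lead_coeff_le:
  fixes p :: "complex poly"
  assumes r: "r > 0" and M: "\<And>z. norm z = r \<Longrightarrow> norm (poly p z) \<le> M"
  shows "norm (lead_coeff p) \<le> M / r ^ degree p"
proof -
  \<comment> \<open>The inequality of order 0 on the circle of radius \<open>1 / r\<close>, which
    inversion maps to \<open>norm z = r\<close>; the reflected polynomial takes the value
    \<open>lead_coeff p\<close> at 0.\<close>
  have "norm ((deriv ^^ 0) (poly (reflect_poly p)) 0) \<le> fact 0 * (M / r ^ degree p) / (1 / r) ^ 0"
  proof (rule Cauchy_inequality)
    fix x :: complex assume x: "norm (0 - x) = 1 / r"
    then have "x \<noteq> 0" using r by auto
    moreover have "norm (poly p (inverse x)) \<le> M" using x r by (intro M) (simp add: norm_inverse)
    ultimately show "norm (poly (reflect_poly p) x) \<le> M / r ^ degree p"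
      using x r by (simp add: poly_reflect_poly_nz norm_mult norm_power power_one_over divide_right_mono)
  qed (use r in \<open>auto intro!: holomorphic_intros continuous_intros\<close>)
  then show ?thesis by (simp add: poly_0_coeff_0)
qed

text \<open>A finite bound excludes the value \<infinity>, so the series converges and dominates
  each of its nonnegative terms.\<close>

lemma norm_ceval_le_P_fun:
  assumes "P_fun P z \<le> ereal B"
  shows "cmod (ceval (P n) z) \<le> B"
proof -
  let ?f = "\<lambda>n. (cmod (ceval (P n) z))\<^sup>2"
  have f: "summable ?f" "sqrt (suminf ?f) \<le> B"
    using assms by (auto simp: P_fun_def split: if_splits)
  have "sum ?f {n} \<le> suminf ?f" using f(1) by (intro sum_le_suminf) auto
  then have "cmod (ceval (P n) z) \<le> sqrt (suminf ?f)" by (simp add: real_le_rsqrt)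
  then show ?thesis using f(2) by simp
qed

text \<open>Compare coefficients of degree \<open>Suc n\<close> in the recurrence; the terms with
  \<open>a n\<close> and \<open>b (n - 1)\<close> have too small a degree to contribute.\<close>

lemma lead_coeff_jacobi:
  assumes rec: "jacobi_recurrence a b 0 1 P" and deg: "\<And>n. degree (P n) = n"
    and b: "\<And>n. b n \<noteq> 0"
  shows "lead_coeff (P n) = 1 / (\<Prod>k<n. b k)"
proof (induction n)
  case 0
  then show ?case using rec by (simp add: jacobi_recurrence_def)
next
  case (Suc n)
  have "coeff (monom 1 1 * P n) (Suc n) =
      coeff (smult (b n) (P (Suc n)) + smult (a n) (P n) +
        (case n of 0 \<Rightarrow> 0 | Suc m \<Rightarrow> smult (b m) (P m))) (Suc n)"
    using rec by (simp add: jacobi_recurrence_def)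
  then have "coeff (P n) n = b n * coeff (P (Suc n)) (Suc n)"
    by (simp add: coeff_monom_mult coeff_eq_0 deg split: nat.splits)
  then show ?case using Suc b by (auto simp: deg divide_simps ac_simps)
qed

lemma inverse_bigo_of_growth:
  fixes \<alpha> C K :: real
  assumes rec: "jacobi_recurrence a b 0 1 P" and deg: "\<And>n. degree (P n) = n"
    and pos: "\<And>n. b n > 0" and incr: "\<And>n. n \<ge> N \<Longrightarrow> b n \<le> b (Suc n)"
    and \<alpha>: "\<alpha> > 0" and C: "C > 0"
    and growth: "\<And>z. P_fun P z \<le> ereal (C * exp (K * cmod z powr \<alpha>))"
  shows "(\<lambda>n. 1 / b n) \<in> O(\<lambda>n. real n powr (- 1 / \<alpha>))"
proof -
  \<comment> \<open>Chosen to give equality in \<open>prod_le\<close> at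
    \<open>n = N\<close>.\<close>
  define D where "D = (\<Prod>k<N. b k) / b N ^ N"
  have D: "D > 0" using pos by (simp add: D_def prod_pos)
  have prod_le: "(\<Prod>k<n. b k) \<le> D * b n ^ n" if "n \<ge> N" for n
    using that
  proof (induction n rule: dec_induct)
    case base
    then show ?case using pos[of N] by (simp add: D_def)
  next
    case (step n)
    have "(\<Prod>k<Suc n. b k) \<le> D * b n ^ n * b n"
      using step pos[of n] by (simp add: mult_right_mono)
    also have "\<dots> = D * b n ^ Suc n" by simp
    also have "\<dots> \<le> D * b (Suc n) ^ Suc n"
      using D pos[of n] incr[of n] step by (intro mult_left_mono power_mono) auto
    finally show ?case .
  qed
  \<comment> \<open>The maximum with 1 ensures that the constant \<open>D * C\<close> is at most an
    \<open>n\<close>-th power, so that taking \<open>n\<close>-th roots leaves a factor independent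
    of \<open>n\<close>.\<close>
  define E where "E = max 1 (D * C) * exp K"
  have "norm (1 / b n) \<le> E * norm (real n powr (- 1 / \<alpha>))" if n: "n \<ge> max 1 N" for n
  proof -
    \<comment> \<open>With this radius the growth bound becomes \<open>C * exp K ^ n\<close>, again
      an \<open>n\<close>-th power up to a constant.\<close>
    define r where "r = real n powr (1 / \<alpha>)"
    have r: "r > 0" using n by (simp add: r_def)
    have ra: "r powr \<alpha> = n" using \<alpha> by (simp add: r_def powr_powr)
    let ?p = "map_poly complex_of_real (P n)"
    have "norm (lead_coeff ?p) \<le> C * exp (K * n) / r ^ degree ?p"
    proof (rule norm_lead_coeff_le[OF r])
      fix z assume "cmod z = r"
      then show "cmod (poly ?p z) \<le> C * exp (K * n)"
        using norm_ceval_le_P_fun[OF growth[of z], of n] ra by (simp add: ceval_def)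
    qed
    moreover have "norm (lead_coeff ?p) = 1 / (\<Prod>k<n. b k)"
      using lead_coeff_jacobi[OF rec deg, of n] pos
      by (simp add: deg degree_map_poly coeff_map_poly less_imp_neq[symmetric] prod_pos abs_of_pos
        norm_divide del: of_real_prod)
    ultimately have le: "1 / (\<Prod>k<n. b k) \<le> C * exp K ^ n / r ^ n"
      by (simp add: deg degree_map_poly exp_of_nat2_mult)
    have B: "(\<Prod>k<n. b k) > 0" using pos by (simp add: prod_pos)
    have "(1 / b n) ^ n \<le> D * (1 / (\<Prod>k<n. b k))"
      using prod_le[of n] n B pos[of n] by (simp add: field_simps)
    also have "\<dots> \<le> D * (C * exp K ^ n / r ^ n)"
      using le D by (intro mult_left_mono) auto
    also have "\<dots> = (D * C) * (exp K / r) ^ n" by (simp add: power_divide)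
    also have "\<dots> \<le> max 1 (D * C) ^ n * (exp K / r) ^ n"
    proof -
      have "D * C \<le> max 1 (D * C) ^ 1" by simp
      also have "\<dots> \<le> max 1 (D * C) ^ n" using n by (intro power_increasing) auto
      finally show ?thesis using r by (intro mult_right_mono) auto
    qed
    also have "\<dots> = (E / r) ^ n" by (simp add: E_def power_mult_distrib power_divide)
    finally have "1 / b n \<le> E / r"
      using n r pos[of n] by (subst (asm) power_mono_iff) (auto simp: E_def)
    then show ?thesis using pos[of n] by (simp add: r_def powr_minus field_simps)
  qed
  then show ?thesis
    by (intro bigoI[of _ E]) (meson eventually_sequentiallyI)
qed

section \<open>Index shifts and summability of power rates\<close>

lemma bigo_powr_of_Suc:
  fixes f :: "nat \<Rightarrow> real"
  assumes "(\<lambda>n. f (Suc n)) \<in> O(\<lambda>n. real n powr c)"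
  shows "f \<in> O(\<lambda>n. real n powr c)"
proof -
  have "(\<lambda>n. real n powr c) \<in> O(\<lambda>n. real (Suc n) powr c)" by (cases c "0 :: real" rule: linorder_cases) real_asymp+
  with assms have "(\<lambda>n. f (Suc n)) \<in> O(\<lambda>n. real (Suc n) powr c)"
    by (rule landau_o.big.trans)
  then obtain d where "\<forall>\<^sub>F n in sequentially. norm (f (Suc n)) \<le> d * norm (real (Suc n) powr c)"
    by (auto elim: landau_o.bigE)
  then have "\<forall>\<^sub>F n in sequentially. norm (f n) \<le> d * norm (real n powr c)"
    using eventually_sequentially_Suc[of "\<lambda>n. norm (f n) \<le> d * norm (real n powr c)"] by blast
  then show ?thesis by (rule bigoI)
qed

text \<open>Raising the bound to the power \<beta> gives the exponent
  \<open>- \<beta> / \<alpha>\<close>, which is less than -1, so the comparison series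
  converges.\<close>

lemma ell_of_bigo_powr:
  fixes f :: "nat \<Rightarrow> real"
  assumes f: "f \<in> O(\<lambda>n. real n powr (- 1 / \<alpha>))" and \<alpha>: "0 < \<alpha>" "\<alpha> < \<beta>"
  shows "f \<in> ell \<beta>"
proof -
  obtain d where d: "d > 0" "\<forall>\<^sub>F n in sequentially. norm (f n) \<le> d * norm (real n powr (- 1 / \<alpha>))"
    using f by (auto elim: landau_o.bigE)
  have "\<forall>\<^sub>F n in sequentially. norm (\<bar>f n\<bar> powr \<beta>) \<le> d powr \<beta> * real n powr (- \<beta> / \<alpha>)"
    using d(2)
  proof eventually_elim
    case (elim n)
    then have "\<bar>f n\<bar> powr \<beta> \<le> (d * real n powr (- 1 / \<alpha>)) powr \<beta>"
      using \<alpha> by (intro powr_mono2) auto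
    also have "\<dots> = d powr \<beta> * real n powr (- \<beta> / \<alpha>)"
      using d(1) by (simp add: powr_mult powr_powr)
    finally show ?case by simp
  qed
  moreover have "summable (\<lambda>n. d powr \<beta> * real n powr (- \<beta> / \<alpha>))"
    using \<alpha> by (intro summable_mult) (simp add: summable_real_powr_iff field_simps)
  ultimately show ?thesis
    unfolding ell_def mem_Collect_eq by (rule summable_comparison_test_ev)
qed

lemma jacobi_recurrence_at_0:
  assumes "jacobi_recurrence a b u v r"
  shows "b (Suc n) * poly (r (n + 2)) 0 + a (Suc n) * poly (r (Suc n)) 0 + b n * poly (r n) 0 = 0"
proof -
  have "poly (monom 1 1 * r (Suc n)) 0 =
      poly (smult (b (Suc n)) (r (Suc (Suc n))) + smult (a (Suc n)) (r (Suc n)) + smult (b n) (r n)) 0"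
    using assms by (simp add: jacobi_recurrence_def)
  then show ?thesis by (simp add: poly_monom)
qed

theorem theorem4p8:
  fixes s a b :: "nat \<Rightarrow> real" and \<mu> :: "real measure"
    and P Q :: "nat \<Rightarrow> real poly" and \<alpha> C K :: real and n0 :: nat
  assumes "hamburger_data s \<mu> P Q a b"
    and "summable (\<lambda>n. (1 + \<bar>a (Suc n)\<bar>) / sqrt (b (Suc n) * b n))"
    and "n0 \<ge> 1"
    and "(\<forall>n\<ge>n0. (b n)\<^sup>2 \<le> b (n - 1) * b (n + 1)) \<or>
         (\<forall>n\<ge>n0. (b n)\<^sup>2 \<ge> b (n - 1) * b (n + 1))"
    and "0 < \<alpha>" and "\<alpha> < 1" and "C > 0" and "K > 0"
    and "\<And>z. P_fun P z \<le> ereal (C * exp (K * cmod z powr \<alpha>))"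
  shows "((\<lambda>n. 1 / b n) \<in> O(\<lambda>n. real n powr (- 1 / \<alpha>)) \<and>
          (\<lambda>n. (poly (P n) 0)\<^sup>2) \<in> O(\<lambda>n. real n powr (- 1 / \<alpha>)) \<and>
          (\<lambda>n. (poly (Q n) 0)\<^sup>2) \<in> O(\<lambda>n. real n powr (- 1 / \<alpha>))) \<and>
         (\<forall>\<epsilon>>0. (\<lambda>n. 1 / b n) \<in> ell (\<alpha> + \<epsilon>) \<and>
                 (\<lambda>n. (poly (P n) 0)\<^sup>2) \<in> ell (\<alpha> + \<epsilon>) \<and>
                 (\<lambda>n. (poly (Q n) 0)\<^sup>2) \<in> ell (\<alpha> + \<epsilon>))"
proof -
  have pos: "b n > 0" and deg: "degree (P n) = n"
    and recP: "jacobi_recurrence a b 0 1 P" and recQ: "jacobi_recurrence a b (- 1) 0 Q" for n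
    using assms(1) by (auto simp: hamburger_data_def orthonormal_polys_def)
  \<comment> \<open>Recentring at \<open>Suc n\<close> removes the subtraction on naturals;
    \<open>n0\<close> stays valid since \<open>n \<ge> n0\<close> implies
    \<open>Suc n \<ge> n0\<close>.\<close>
  have reg: "(\<forall>n\<ge>n0. (b (Suc n))\<^sup>2 \<le> b n * b (n + 2)) \<or>
             (\<forall>n\<ge>n0. (b (Suc n))\<^sup>2 \<ge> b n * b (n + 2))"
    using assms(4)
  proof
    assume h: "\<forall>n\<ge>n0. (b n)\<^sup>2 \<le> b (n - 1) * b (n + 1)"
    have "(b (Suc n))\<^sup>2 \<le> b n * b (n + 2)" if "n \<ge> n0" for n
      using h[rule_format, of "Suc n"] that by simp
    then show ?thesis by blast
  next
    assume h: "\<forall>n\<ge>n0. (b n)\<^sup>2 \<ge> b (n - 1) * b (n + 1)"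
    have "(b (Suc n))\<^sup>2 \<ge> b n * b (n + 2)" if "n \<ge> n0" for n
      using h[rule_format, of "Suc n"] that by simp
    then show ?thesis by blast
  qed
  have "summable (\<lambda>n. 1 / sqrt (b (Suc n) * b n))"
    using assms(2)
  proof (rule summable_comparison_test'[where N = 0])
    fix n
    show "norm (1 / sqrt (b (Suc n) * b n)) \<le> (1 + \<bar>a (Suc n)\<bar>) / sqrt (b (Suc n) * b n)"
      using pos[of n] pos[of "Suc n"] by (simp add: divide_right_mono)
  qed
  then obtain N where incr: "\<And>n. n \<ge> N \<Longrightarrow> b n \<le> b (Suc n)"
    using log_regular_eventually_incseq[OF pos _ reg] by blast
  have b_bigo: "(\<lambda>n. 1 / b n) \<in> O(\<lambda>n. real n powr (- 1 / \<alpha>))"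
    by (rule inverse_bigo_of_growth[OF recP deg pos incr \<open>0 < \<alpha>\<close> \<open>C > 0\<close> assms(9)])
  \<comment> \<open>Stated for arbitrary initial values, since \<open>P\<close> and \<open>Q\<close>
    obey the same recurrence from index 1 on. The square at \<open>Suc n\<close> is compared with
    \<open>1 / b n\<close>, hence the index shift.\<close>
  have r_bigo: "(\<lambda>n. (poly (r n) 0)\<^sup>2) \<in> O(\<lambda>n. real n powr (- 1 / \<alpha>))"
    if "jacobi_recurrence a b u v r" for u v r
  proof (rule bigo_powr_of_Suc)
    show "(\<lambda>n. (poly (r (Suc n)) 0)\<^sup>2) \<in> O(\<lambda>n. real n powr (- 1 / \<alpha>))"
      using recurrence_solution_square_bigo[OF pos assms(2) reg incr, of N "\<lambda>n. poly (r n) 0"]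
        jacobi_recurrence_at_0[OF that] b_bigo
      by (blast intro: landau_o.big.trans)
  qed
  show ?thesis
    using b_bigo r_bigo[OF recP] r_bigo[OF recQ] \<open>0 < \<alpha>\<close>
    by (auto intro!: ell_of_bigo_powr)
qed

end
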